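(* Let $f_1,\dots,f_n:\mathbb{R}^d\to\mathbb{R}$ and let $x^*$ be the minimizer of $\frac1n\sum_{i=1}^n f_i$ over $\mathbb{R}^d$. Suppose that: (i) the graph $\mathcal{G}=\mathcal{G}(\mathcal{V},\mathcal{E})$ is static and connected, and each $f_i$ is $L$-smooth and $\mu$-strongly convex; (ii) $\mathbf{Q}_k$ are doubly stochastic matrices and $\hat{\mathbf{Q}}_k=\mathbf{Q}_k$ for $k\ge 0$. Let $x_{i,k}$ denote the iterates generated via the recursions $$\mathbf{x}_{k+1}=\mathbf{Q}_k(\mathbf{x}_k-\alpha\mathbf{y}_k),\qquad \mathbf{y}_{k+1}=\hat{\mathbf{Q}}_k\mathbf{y}_k+\nabla\mathbf{f}(\mathbf{x}_{k+1})-\nabla\mathbf{f}(\mathbf{x}_k),$$ with arbitrary $x_{i,0}\in\mathbb{R}^d$ and $y_{i,0}=\nabla f_i(x_{i,0})$ for all $i\in[n]$, and let $\bar x_k:=\frac1n\sum_{i=1}^n x_{i,k}$. Then, for all $k\ge 0$, $$\|\bar x_k-x^*\|^2\le\left(1-\frac{\alpha\mu}{4}\right)^k\left(\|\bar x_0-x^*\|^2+\frac{1000L(1+\tau'^2)}{\mu n\left(1-\frac{\alpha\mu}{4}\right)}\left(\|\mathbf{x}_0-\bar{\mathbf{x}}_0\|^2+\alpha^2\|\mathbf{y}_0-\bar{\mathbf{y}}_0\|^2\right)\right),$$ where $\tau'\in\mathbb{N}$ is such that $$\rho':=2(1+\tau'^2)\max_{\tau'\le t\le k}\left\|\mathbf{Q}[t-\tau':t]-\mathbf{J}\right\|^2<\frac14,$$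 and the step size $\alpha>0$ satisfies $$\alpha<\min\left\{1,\frac{\sqrt{\rho'}}{58L\tau'^2}\right\}.$$
   Context: Notation. $[n]=\{1,\dots,n\}$; $\mathbb{N}$ is the set of strictly positive integers; $\|\cdot\|$ is the Euclidean norm of vectors and the induced (spectral) norm of matrices; $\otimes$ is the Kronecker product. $\mathbf{J}:=\frac1n 1_n1_n^T\otimes I_d\in\mathbb{R}^{nd\times nd}$ is the averaging matrix, $1_n\in\mathbb{R}^n$ being the all-ones vector. For node vectors $x_{1,k},\dots,x_{n,k}\in\mathbb{R}^d$, $\mathbf{x}_k=[x_{1,k},\dots,x_{n,k}]\in\mathbb{R}^{nd}$ is the stacked vector, $\bar x_k=\frac1n\sum_i x_{i,k}$, $\bar{\mathbf{x}}_k=[\bar x_k,\dots,\bar x_k]\in\mathbb{R}^{nd}$; similarly for $y_{i,k},\mathbf{y}_k,\bar{\mathbf{y}}_k$. $\nabla\mathbf{f}(\mathbf{x}_k)=[\nabla f_1(x_{1,k}),\dots,\nabla f_n(x_{n,k})]\in\mathbb{R}^{nd}$. Setting. $\mathcal{G}(\mathcal{V},\mathcal{E})$ is an undirected graph with $\mathcal{V}=[n]$. Fix a cycle length $\tau\in\mathbb{N}$. $\mathbf{Q}_k=Q_{\lfloor k/\tau\rfloor}\otimes I_d$ and $\hat{\mathbf{Q}}_k=\hat Q_{\lfloor k/\tau\rfloor}\otimes I_d$, where $Q_m,\hat Q_m\in\mathbb{R}^{n\times n}$ are mixing matrices of pruned graphs (undirected graphs on $\mathcal{V}$ with edges contained in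 $\mathcal{E}$) used during the $m$-th cycle of $\tau$ iterations. A mixing matrix of a graph on $[n]$ is a matrix $[q_{ij}]$ with nonnegative entries, $q_{ij}=q_{ji}$, and for $i\ne j$, $q_{ij}>0$ if and only if $i$ and $j$ are joined by an edge. For $r<s$, $\mathbf{Q}[r:s]:=\mathbf{Q}_{s-1}\mathbf{Q}_{s-2}\cdots\mathbf{Q}_r$. $f_i$ is $L$-smooth if it is differentiable with $L$-Lipschitz gradient, and $\mu$-strongly convex ($\mu>0$) if $f_i(v)\ge f_i(u)+\langle\nabla f_i(u),v-u\rangle+\frac{\mu}{2}\|v-u\|^2$ for all $u,v$.
   Formalization: For k < τ' the maximum over τ' ≤ t ≤ k is over an empty set, so ρ' is undefined; the formal statement takes the maximum over τ' ≤ t ≤ max(τ', k), i.e. the single window t = τ' in that case; for k ≥ τ' nothing is changed. *)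

theory Defs
  imports "HOL-Analysis.Analysis"
begin

definition kronecker :: "real^('a::finite)^('b::finite) \<Rightarrow> real^('c::finite)^('e::finite) \<Rightarrow> real^('a \<times> 'c)^('b \<times> 'e)"
  where "kronecker A B = (\<chi> p q. A $ fst p $ fst q * B $ snd p $ snd q)"

definition stack :: "('n::finite \<Rightarrow> real^('d::finite)) \<Rightarrow> real^('n \<times> 'd)"
  where "stack x = (\<chi> p. x (fst p) $ snd p)"

definition node_mean :: "('n::finite \<Rightarrow> real^'d) \<Rightarrow> real^'d"
  where "node_mean x = (1 / real CARD('n)) *\<^sub>R (\<Sum>i\<in>UNIV. x i)"

definition averaging_matrix :: "real^('n::finite \<times> 'd::finite)^('n \<times> 'd)"
  where "averaging_matrix = kronecker ((1 / real CARD('n)) *\<^sub>R (\<chi> i j. 1)) (mat 1)"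

text \<open>The library's \<open>norm\<close> on \<open>real^'m^'k\<close> is the Frobenius norm; the spectral norm is the
  operator norm of the associated linear map.\<close>

definition spectral_norm :: "real^'m^'k \<Rightarrow> real"
  where "spectral_norm A = onorm (\<lambda>v. A *v v)"

text \<open>For \<open>r < s\<close>, \<open>matrix_window Q r s\<close> is \<open>Q (s - 1) ** \<dots> ** Q r\<close>.\<close>

primrec matrix_window :: "(nat \<Rightarrow> real^'m^'m) \<Rightarrow> nat \<Rightarrow> nat \<Rightarrow> real^'m^'m" where
  "matrix_window Q r 0 = mat 1"
| "matrix_window Q r (Suc s) = (if r \<le> s then Q s ** matrix_window Q r s else mat 1)"

definition doubly_stochastic :: "real^'m^'m \<Rightarrow> bool"
  where "doubly_stochastic A \<longleftrightarrow>
    (\<forall>i j. 0 \<le> A $ i $ j) \<and> (\<forall>i. (\<Sum>j\<in>UNIV. A $ i $ j) = 1) \<and> (\<forall>j. (\<Sum>i\<in>UNIV. A $ i $ j) = 1)"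

text \<open>An undirected graph on the vertex set \<open>UNIV :: 'n set\<close> is given by a symmetric edge relation;
  self-loops play no role below.\<close>

definition connected_graph :: "('n \<times> 'n) set \<Rightarrow> bool"
  where "connected_graph E \<longleftrightarrow> (\<forall>i j. (i, j) \<in> E\<^sup>*)"

definition mixing_matrix :: "('n \<times> 'n) set \<Rightarrow> real^'n^'n \<Rightarrow> bool"
  where "mixing_matrix F A \<longleftrightarrow>
    (\<forall>i j. 0 \<le> A $ i $ j) \<and> (\<forall>i j. A $ i $ j = A $ j $ i) \<and>
    (\<forall>i j. i \<noteq> j \<longrightarrow> (0 < A $ i $ j \<longleftrightarrow> (i, j) \<in> F))"

definition pruned_mixing_matrix :: "('n \<times> 'n) set \<Rightarrow> real^'n^'n \<Rightarrow> bool"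
  where "pruned_mixing_matrix E A \<longleftrightarrow> (\<exists>F. sym F \<and> F \<subseteq> E \<and> mixing_matrix F A)"

definition gradient :: "('a::real_inner \<Rightarrow> real) \<Rightarrow> 'a \<Rightarrow> 'a"
  where "gradient f x = (THE g. GDERIV f x :> g)"

definition L_smooth :: "real \<Rightarrow> ('a::real_inner \<Rightarrow> real) \<Rightarrow> bool"
  where "L_smooth L f \<longleftrightarrow> (\<forall>x. f differentiable (at x)) \<and> L-lipschitz_on UNIV (gradient f)"

definition strongly_convex :: "real \<Rightarrow> ('a::real_inner \<Rightarrow> real) \<Rightarrow> bool"
  where "strongly_convex \<mu> f \<longleftrightarrow> 0 < \<mu> \<and>
    (\<forall>u v. f v \<ge> f u + gradient f u \<bullet> (v - u) + \<mu> / 2 * (norm (v - u))\<^sup>2)"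

lemma gradient_eq:
  assumes "GDERIV f x :> g"
  shows "gradient f x = g"
  unfolding gradient_def
proof (rule the_equality)
  show "GDERIV f x :> g" by (fact assms)
next
  fix h assume "GDERIV f x :> h"
  with assms have "(\<lambda>v. v \<bullet> h) = (\<lambda>v. v \<bullet> g)"
    unfolding gderiv_def by (metis has_derivative_unique)
  then have "v \<bullet> (h - g) = 0" for v
    by (metis inner_diff_right diff_self)
  from this[of "h - g"] show "h = g" by simp
qed

lemma GDERIV_gradient:
  fixes f :: "'a::euclidean_space \<Rightarrow> real"
  assumes "f differentiable (at x)"
  shows "GDERIV f x :> gradient f x"
proof -
  obtain f' where f': "(f has_derivative f') (at x)"
    using assms unfolding differentiable_def by blast
  have lin: "linear f'" using f' has_derivative_linear by blast
  have "f' v = v \<bullet> (\<Sum>b\<in>Basis. f' b *\<^sub>R b)" for v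
  proof -
    have "f' v = f' (\<Sum>b\<in>Basis. (v \<bullet> b) *\<^sub>R b)" by (simp add: euclidean_representation)
    also have "\<dots> = (\<Sum>b\<in>Basis. (v \<bullet> b) * f' b)"
      by (simp add: linear_sum[OF lin] linear_scale[OF lin])
    also have "\<dots> = v \<bullet> (\<Sum>b\<in>Basis. f' b *\<^sub>R b)"
      by (simp add: inner_sum_right mult.commute)
    finally show ?thesis .
  qed
  then have "f' = (\<lambda>v. v \<bullet> (\<Sum>b\<in>Basis. f' b *\<^sub>R b))" by (rule ext)
  with f' have "GDERIV f x :> (\<Sum>b\<in>Basis. f' b *\<^sub>R b)"
    unfolding gderiv_def by metis
  then show ?thesis using gradient_eq by metis
qed

end

theory Submission
  imports Defs
begin

text \<open>
  Let \<open>X\<close>, \<open>Y\<close> be the deviations of the stacked iterates from their node means,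
  \<open>V = |X|\<^sup>2 + \<alpha>\<^sup>2 |Y|\<^sup>2\<close>, and \<open>D\<close> the optimality gap of \<open>\<Sum>i. f i\<close> at the mean iterate. The mean
  performs a gradient step with inexact gradient, so its squared distance to the minimizer
  contracts by \<open>1 - \<alpha>\<mu>\<close> up to \<open>(3 \<alpha> L V - \<alpha> D) / n\<close>. Over a window of length \<open>\<tau>'\<close> the mixing
  matrices contract \<open>V\<close> by \<open>2 \<rho>' < 1/2\<close>, up to a forcing by the gradient increments in the window,
  which are bounded by \<open>V\<close> and \<open>\<alpha>\<^sup>2 L D\<close>. Summing with weights \<open>(1 - \<alpha>\<mu>/4) ^ (-t)\<close>, which are almost
  constant over a window, bounds the weighted sum of \<open>V\<close> by \<open>\<tau>' (1 + \<tau>'\<^sup>2) V 0\<close> plus a small multiple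
  of the weighted sum of \<open>\<alpha>\<^sup>2 L D\<close>; the latter is absorbed by the negative term \<open>- \<alpha> D\<close>.
\<close>

section \<open>Doubly stochastic matrices, Kronecker products and averaging\<close>

text \<open>Jensen's inequality in each row: the row sum 1 makes \<open>(A *v z) $ i\<close> a
  weighted mean, and the weighted variance around it is nonnegative. After exchanging the sums, the
  column sums 1 return the squared norm of \<open>z\<close>.\<close>

lemma norm_contraction_doubly_stochastic:
  fixes A :: "real^'m^'m"
  assumes "doubly_stochastic A"
  shows "norm (A *v z) \<le> norm z"
proof -
  have nonneg: "0 \<le> A $ i $ j" and row: "(\<Sum>j\<in>UNIV. A $ i $ j) = 1"
    and col: "(\<Sum>i\<in>UNIV. A $ i $ j) = 1" for i j
    using assms by (auto simp: doubly_stochastic_def)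
  have "((A *v z) $ i)\<^sup>2 \<le> (\<Sum>j\<in>UNIV. A $ i $ j * (z $ j)\<^sup>2)" for i
  proof -
    define m where "m = (A *v z) $ i"
    have m: "(\<Sum>j\<in>UNIV. A $ i $ j * z $ j) = m"
      by (simp add: m_def matrix_vector_mult_def)
    have "0 \<le> (\<Sum>j\<in>UNIV. A $ i $ j * (z $ j - m)\<^sup>2)"
      by (intro sum_nonneg mult_nonneg_nonneg nonneg) auto
    also have "\<dots> = (\<Sum>j\<in>UNIV. A $ i $ j * (z $ j)\<^sup>2 - 2 * m * (A $ i $ j * z $ j) + m\<^sup>2 * A $ i $ j)"
      by (intro sum.cong refl) (simp add: power2_eq_square algebra_simps)
    also have "\<dots> = (\<Sum>j\<in>UNIV. A $ i $ j * (z $ j)\<^sup>2) - 2 * m * m + m\<^sup>2"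
      by (simp add: sum.distrib sum_subtractf sum_distrib_left[symmetric] m row)
    finally show ?thesis by (simp add: m_def power2_eq_square)
  qed
  then have "(\<Sum>i\<in>UNIV. ((A *v z) $ i)\<^sup>2) \<le> (\<Sum>i\<in>UNIV. \<Sum>j\<in>UNIV. A $ i $ j * (z $ j)\<^sup>2)"
    by (rule sum_mono)
  also have "\<dots> = (\<Sum>j\<in>UNIV. \<Sum>i\<in>UNIV. A $ i $ j * (z $ j)\<^sup>2)"
    by (rule sum.swap)
  also have "\<dots> = (\<Sum>j\<in>UNIV. (z $ j)\<^sup>2)"
    by (simp add: sum_distrib_right[symmetric] col)
  finally have "sqrt (\<Sum>i\<in>UNIV. ((A *v z) $ i)\<^sup>2) \<le> sqrt (\<Sum>j\<in>UNIV. (z $ j)\<^sup>2)"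
    by simp
  then show ?thesis by (simp add: norm_vec_def L2_set_def)
qed

lemma sum_UNIV_prod:
  fixes g :: "'a::finite \<times> 'b::finite \<Rightarrow> 'c::comm_monoid_add"
  shows "(\<Sum>p\<in>UNIV. g p) = (\<Sum>i\<in>UNIV. \<Sum>j\<in>UNIV. g (i, j))"
  using sum.Sigma[of UNIV "\<lambda>_. UNIV" "\<lambda>i j. g (i, j)"] by simp

lemma kronecker_matrix_mult:
  "kronecker A B ** kronecker C D = kronecker (A ** C) (B ** D)"
  by (simp add: kronecker_def matrix_matrix_mult_def vec_eq_iff sum_product sum_UNIV_prod
      mult.assoc mult.left_commute)

text \<open>Double stochasticity is assumed for the block matrices, while absorption of the
  averaging matrix is derived from the small factor. Types are inhabited, so some coordinate
  \<open>b\<close> exists, and the rows and columns of the Kronecker product through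
  \<open>b\<close> have the same sums as those of \<open>Q\<close>.\<close>

lemma doubly_stochastic_kronecker_mat1D:
  fixes Q :: "real^'n^'n"
  assumes "doubly_stochastic (kronecker Q (mat 1 :: real^'d^'d))"
  shows "doubly_stochastic Q"
proof -
  let ?K = "kronecker Q (mat 1 :: real^'d^'d)"
  fix b :: 'd
  have row: "(\<Sum>q\<in>UNIV. ?K $ (i, b) $ q) = (\<Sum>j\<in>UNIV. Q $ i $ j)" for i
    by (simp add: kronecker_def mat_def sum_UNIV_prod if_distrib cong: if_cong)
  have col: "(\<Sum>p\<in>UNIV. ?K $ p $ (j, b)) = (\<Sum>i\<in>UNIV. Q $ i $ j)" for j
    by (simp add: kronecker_def mat_def sum_UNIV_prod if_distrib cong: if_cong)
  have "?K $ (i, b) $ (j, b) = Q $ i $ j" for i j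
    by (simp add: kronecker_def mat_def)
  then show ?thesis
    using assms row col unfolding doubly_stochastic_def by metis
qed

text \<open>Mixing fixes consensus vectors and preserves node means. This is why the deviations from
  the mean obey the same recursions as the iterates.\<close>

lemma averaging_matrix_absorbs:
  fixes Q :: "real^'n^'n"
  assumes "doubly_stochastic Q"
  shows "kronecker Q (mat 1) ** (averaging_matrix :: real^('n \<times> 'd::finite)^('n \<times> 'd)) = averaging_matrix"
    and "(averaging_matrix :: real^('n \<times> 'd::finite)^('n \<times> 'd)) ** kronecker Q (mat 1) = averaging_matrix"
proof -
  have "(\<Sum>j\<in>UNIV. Q $ i $ j) = 1" "(\<Sum>j\<in>UNIV. Q $ j $ i) = 1" for i
    using assms by (auto simp: doubly_stochastic_def)
  then have "Q ** ((1 / real CARD('n)) *\<^sub>R ((\<chi> i j. 1) :: real^'n^'n)) = (1 / real CARD('n)) *\<^sub>R ((\<chi> i j. 1) :: real^'n^'n)"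
    "((1 / real CARD('n)) *\<^sub>R ((\<chi> i j. 1) :: real^'n^'n)) ** Q = (1 / real CARD('n)) *\<^sub>R ((\<chi> i j. 1) :: real^'n^'n)"
    by (simp_all add: matrix_matrix_mult_def vec_eq_iff sum_divide_distrib[symmetric])
  then show "kronecker Q (mat 1) ** (averaging_matrix :: real^('n \<times> 'd::finite)^('n \<times> 'd)) = averaging_matrix"
    "(averaging_matrix :: real^('n \<times> 'd::finite)^('n \<times> 'd)) ** kronecker Q (mat 1) = averaging_matrix"
    by (simp_all add: averaging_matrix_def kronecker_matrix_mult)
qed

section \<open>Stacked vectors, node means and squared norms\<close>

lemma averaging_matrix_stack:
  fixes w :: "'n::finite \<Rightarrow> real^'d::finite"
  shows "averaging_matrix *v stack w = stack (\<lambda>_. node_mean w)"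
  by (simp add: averaging_matrix_def kronecker_def stack_def node_mean_def mat_def
      matrix_vector_mult_def vec_eq_iff sum_UNIV_prod if_distrib if_distribR
      sum_divide_distrib sum_distrib_left cong: if_cong)

lemma stack_simps:
  "stack (\<lambda>i. u i + v i) = stack u + stack v"
  "stack (\<lambda>i. u i - v i) = stack u - stack v"
  "stack (\<lambda>i. c *\<^sub>R u i) = c *\<^sub>R stack u"
  by (simp_all add: stack_def vec_eq_iff)

lemma stack_inject: "stack u = stack v \<longleftrightarrow> u = v"
  by (force simp: stack_def vec_eq_iff fun_eq_iff)

lemma norm_stack_squared: "(norm (stack w))\<^sup>2 = (\<Sum>i\<in>UNIV. (norm (w i))\<^sup>2)"
  by (simp add: stack_def norm_vec_def L2_set_def sum_nonneg sum_UNIV_prod)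

lemma node_mean_diff: "node_mean (\<lambda>i. u i - v i) = node_mean u - node_mean v"
  by (simp add: node_mean_def sum_subtractf scaleR_diff_right)

lemma node_mean_const: "node_mean (\<lambda>i :: 'n::finite. a) = a"
  by (simp add: node_mean_def sum_constant_scaleR del: sum_constant)

lemma inner_node_mean:
  fixes w :: "'n::finite \<Rightarrow> real^'d::finite"
  shows "node_mean w \<bullet> v = (\<Sum>i\<in>UNIV. w i \<bullet> v) / real CARD('n)"
  by (simp add: node_mean_def inner_sum_left)

text \<open>The variance identity. Discarding one or the other of its nonnegative terms shows that
  removing the mean does not increase the norm, and gives Jensen's inequality for
  \<open>node_mean\<close>.\<close>

lemma sum_norm_diff_node_mean:
  fixes w :: "'n::finite \<Rightarrow> real^'d::finite"
  shows "(\<Sum>i\<in>UNIV. (norm (w i - node_mean w))\<^sup>2)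
    = (\<Sum>i\<in>UNIV. (norm (w i))\<^sup>2) - real CARD('n) * (norm (node_mean w))\<^sup>2"
proof -
  have "(\<Sum>i\<in>UNIV. (norm (w i - node_mean w))\<^sup>2)
    = (\<Sum>i\<in>UNIV. (norm (w i))\<^sup>2 - 2 * (w i \<bullet> node_mean w) + (norm (node_mean w))\<^sup>2)"
    by (intro sum.cong refl) (simp add: power2_norm_eq_inner algebra_simps inner_commute)
  also have "\<dots> = (\<Sum>i\<in>UNIV. (norm (w i))\<^sup>2) - 2 * (\<Sum>i\<in>UNIV. w i \<bullet> node_mean w)
      + real CARD('n) * (norm (node_mean w))\<^sup>2"
    by (simp add: sum.distrib sum_subtractf sum_distrib_left)
  also have "(\<Sum>i\<in>UNIV. w i \<bullet> node_mean w) = real CARD('n) * (norm (node_mean w))\<^sup>2"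
    using inner_node_mean[of w "node_mean w"] by (simp add: power2_norm_eq_inner field_simps)
  finally show ?thesis by simp
qed

lemma norm_diff_node_mean_le:
  "norm (stack w - stack (\<lambda>_. node_mean w)) \<le> norm (stack w)"
proof (rule power2_le_imp_le)
  show "(norm (stack w - stack (\<lambda>_. node_mean w)))\<^sup>2 \<le> (norm (stack w))\<^sup>2"
    by (simp add: stack_simps(2)[symmetric] norm_stack_squared sum_norm_diff_node_mean)
qed simp

lemma norm_add_squared_le:
  fixes a b :: "'a::real_inner"
  shows "(norm (a + b))\<^sup>2 \<le> 2 * (norm a)\<^sup>2 + 2 * (norm b)\<^sup>2"
proof -
  have "0 \<le> (norm (a - b))\<^sup>2" by simp
  then show ?thesis by (simp add: power2_norm_eq_inner algebra_simps inner_commute)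
qed

lemma norm_node_mean_squared_le:
  fixes w :: "'n::finite \<Rightarrow> real^'d::finite"
  shows "real CARD('n) * (norm (node_mean w))\<^sup>2 \<le> (\<Sum>i\<in>UNIV. (norm (w i))\<^sup>2)"
  using sum_norm_diff_node_mean[of w] sum_nonneg[of UNIV "\<lambda>i. (norm (w i - node_mean w))\<^sup>2"]
  by simp

section \<open>Smooth and strongly convex functions\<close>

text \<open>Bounding by convexity at \<open>v\<close> instead of integrating the gradient costs a factor 2 in front
  of the quadratic term, which the constants of the theorem absorb.\<close>

lemma strongly_convex_smooth_upper:
  fixes f :: "'a::real_inner \<Rightarrow> real"
  assumes "L_smooth L f" "strongly_convex \<mu> f"
  shows "f v \<le> f u + gradient f u \<bullet> (v - u) + L * (norm (v - u))\<^sup>2"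
proof -
  have sc: "0 < \<mu>" "f u \<ge> f v + gradient f v \<bullet> (u - v) + \<mu> / 2 * (norm (u - v))\<^sup>2"
    using assms(2) by (auto simp: strongly_convex_def)
  have "0 \<le> \<mu> / 2 * (norm (u - v))\<^sup>2" using sc by simp
  then have "f v \<le> f u + gradient f v \<bullet> (v - u)"
    using sc(2) by (simp add: inner_diff_right)
  also have "gradient f v \<bullet> (v - u) = gradient f u \<bullet> (v - u) + (gradient f v - gradient f u) \<bullet> (v - u)"
    by (simp add: inner_diff_left)
  also have "(gradient f v - gradient f u) \<bullet> (v - u) \<le> norm (gradient f v - gradient f u) * norm (v - u)"
    by (rule norm_cauchy_schwarz)
  also have "\<dots> \<le> L * norm (v - u) * norm (v - u)"
    using assms(1) by (intro mult_right_mono) (auto simp: L_smooth_def lipschitz_on_def dist_norm)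
  finally show ?thesis by (simp add: power2_eq_square mult.assoc)
qed

text \<open>Subtract the strong convexity bound at \<open>w\<close> from the smoothness bound at
  \<open>v\<close>, both based at \<open>u\<close>. In the application \<open>u\<close> is the
  iterate of a node, \<open>v\<close> the mean and \<open>w\<close> the minimizer, so the term with
  \<open>L\<close> is the price of evaluating the gradient away from the mean.\<close>

lemma inner_inexact_gradient_ge:
  fixes f :: "'a::real_inner \<Rightarrow> real"
  assumes "L_smooth L f" "strongly_convex \<mu> f"
  shows "f v - f w - L * (norm (u - v))\<^sup>2 + \<mu> / 2 * (norm (u - w))\<^sup>2 \<le> gradient f u \<bullet> (v - w)"
proof -
  have "f w \<ge> f u + gradient f u \<bullet> (w - u) + \<mu> / 2 * (norm (w - u))\<^sup>2"
    using assms(2) by (simp add: strongly_convex_def)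
  moreover have "f v \<le> f u + gradient f u \<bullet> (v - u) + L * (norm (v - u))\<^sup>2"
    by (rule strongly_convex_smooth_upper[OF assms])
  ultimately show ?thesis by (simp add: inner_diff_right norm_minus_commute)
qed

text \<open>A gradient step from \<open>u\<close> cannot bring the sum below its minimum, so the
  decrease guaranteed by smoothness is at most the gap at \<open>u\<close>.\<close>

lemma norm_mean_gradient_le:
  fixes f :: "'n::finite \<Rightarrow> real^'d::finite \<Rightarrow> real"
  assumes smooth: "\<And>i. L_smooth L (f i)" and conv: "\<And>i. strongly_convex \<mu> (f i)"
    and min: "\<And>v. (\<Sum>i\<in>UNIV. f i w) \<le> (\<Sum>i\<in>UNIV. f i v)" and "0 < L"
  shows "real CARD('n) * (norm (node_mean (\<lambda>i. gradient (f i) u)))\<^sup>2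
    \<le> 4 * L * (\<Sum>i\<in>UNIV. f i u - f i w)"
proof -
  define g where "g = node_mean (\<lambda>i. gradient (f i) u)"
  \<comment> \<open>The step length \<open>1 / (2 * L)\<close> minimizes
    \<open>- t * |g|^2 + L * t^2 * |g|^2\<close> over \<open>t\<close>; the minimum is
    \<open>- |g|^2 / (4 * L)\<close>.\<close>
  define v where "v = u - (1 / (2 * L)) *\<^sub>R g"
  have vu: "v - u = - ((1 / (2 * L)) *\<^sub>R g)" by (simp add: v_def)
  have "(\<Sum>i\<in>UNIV. f i v) \<le> (\<Sum>i\<in>UNIV. f i u + gradient (f i) u \<bullet> (v - u) + L * (norm (v - u))\<^sup>2)"
    by (intro sum_mono strongly_convex_smooth_upper[OF smooth conv])
  also have "\<dots> = (\<Sum>i\<in>UNIV. f i u) + real CARD('n) * (g \<bullet> (v - u)) + real CARD('n) * (L * (norm (v - u))\<^sup>2)"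
    by (simp add: sum.distrib g_def inner_node_mean)
  also have "g \<bullet> (v - u) = - (norm g)\<^sup>2 / (2 * L)"
    by (simp add: vu power2_norm_eq_inner)
  also have "L * (norm (v - u))\<^sup>2 = (norm g)\<^sup>2 / (4 * L)"
    using \<open>0 < L\<close> by (simp add: vu power_mult_distrib power2_eq_square field_simps)
  finally have "real CARD('n) * (norm g)\<^sup>2 / (4 * L) \<le> (\<Sum>i\<in>UNIV. f i u) - (\<Sum>i\<in>UNIV. f i v)"
    using \<open>0 < L\<close> by (simp add: field_simps)
  with min[of v] have "real CARD('n) * (norm g)\<^sup>2 / (4 * L) \<le> (\<Sum>i\<in>UNIV. f i u - f i w)"
    by (simp add: sum_subtractf)
  then show ?thesis using \<open>0 < L\<close> by (simp add: g_def field_simps)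
qed

text \<open>The mean of gradients at scattered points is the mean gradient at \<open>u\<close> plus
  a Lipschitz error; splitting the square doubles both contributions.\<close>

lemma norm_tracked_gradient_le:
  fixes f :: "'n::finite \<Rightarrow> real^'d::finite \<Rightarrow> real"
  assumes smooth: "\<And>i. L_smooth L (f i)" and conv: "\<And>i. strongly_convex \<mu> (f i)"
    and min: "\<And>v. (\<Sum>i\<in>UNIV. f i w) \<le> (\<Sum>i\<in>UNIV. f i v)" and "0 < L"
  shows "real CARD('n) * (norm (node_mean (\<lambda>i. gradient (f i) (z i))))\<^sup>2
    \<le> 8 * L * (\<Sum>i\<in>UNIV. f i u - f i w) + 2 * L\<^sup>2 * (\<Sum>i\<in>UNIV. (norm (z i - u))\<^sup>2)"
proof -
  let ?n = "real CARD('n)"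
  let ?g = "node_mean (\<lambda>i. gradient (f i) u)"
  let ?h = "node_mean (\<lambda>i. gradient (f i) (z i) - gradient (f i) u)"
  have "?n * (norm ?h)\<^sup>2 \<le> (\<Sum>i\<in>UNIV. (norm (gradient (f i) (z i) - gradient (f i) u))\<^sup>2)"
    by (rule norm_node_mean_squared_le)
  also have "\<dots> \<le> (\<Sum>i\<in>UNIV. (L * norm (z i - u))\<^sup>2)"
    using smooth by (intro sum_mono power_mono) (auto simp: L_smooth_def lipschitz_on_def dist_norm)
  also have "\<dots> = L\<^sup>2 * (\<Sum>i\<in>UNIV. (norm (z i - u))\<^sup>2)"
    by (simp add: power_mult_distrib sum_distrib_left)
  finally have h: "?n * (norm ?h)\<^sup>2 \<le> L\<^sup>2 * (\<Sum>i\<in>UNIV. (norm (z i - u))\<^sup>2)" .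
  have "node_mean (\<lambda>i. gradient (f i) (z i)) = ?g + ?h"
    by (simp add: node_mean_diff)
  then have "(norm (node_mean (\<lambda>i. gradient (f i) (z i))))\<^sup>2 \<le> 2 * (norm ?g)\<^sup>2 + 2 * (norm ?h)\<^sup>2"
    by (simp only: norm_add_squared_le)
  then have "?n * (norm (node_mean (\<lambda>i. gradient (f i) (z i))))\<^sup>2 \<le> ?n * (2 * (norm ?g)\<^sup>2 + 2 * (norm ?h)\<^sup>2)"
    by (intro mult_left_mono) auto
  then show ?thesis
    using h norm_mean_gradient_le[OF smooth conv min \<open>0 < L\<close>, of u] by (simp add: algebra_simps)
qed

section \<open>Sums over windows and weighted recursions\<close>

text \<open>Each index lies in at most \<open>\<tau>\<close> of the windows.\<close>

lemma sum_windows_le: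
  fixes h :: "nat \<Rightarrow> real"
  assumes "\<And>i. 0 \<le> h i"
  shows "(\<Sum>t<k. \<Sum>i\<in>{t - \<tau>..<t}. h i) \<le> real \<tau> * (\<Sum>i<k. h i)"
proof -
  have "(\<Sum>t<k. \<Sum>i\<in>{t - \<tau>..<t}. h i) = (\<Sum>t<k. \<Sum>i<k. if i < t \<and> t \<le> i + \<tau> then h i else 0)"
    by (rule sum.cong[OF refl], rule sum.mono_neutral_cong_left) auto
  also have "\<dots> = (\<Sum>i<k. \<Sum>t<k. if i < t \<and> t \<le> i + \<tau> then h i else 0)"
    by (rule sum.swap)
  also have "\<dots> \<le> (\<Sum>i<k. real \<tau> * h i)"
  proof (rule sum_mono)
    fix i
    have "(\<Sum>t<k. if i < t \<and> t \<le> i + \<tau> then h i else 0) = (\<Sum>t\<in>{t. t < k \<and> i < t \<and> t \<le> i + \<tau>}. h i)"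
      by (rule sum.mono_neutral_cong_right) auto
    also have "\<dots> \<le> (\<Sum>t\<in>{i<..i + \<tau>}. h i)"
      by (rule sum_mono2) (auto simp: assms)
    finally show "(\<Sum>t<k. if i < t \<and> t \<le> i + \<tau> then h i else 0) \<le> real \<tau> * h i" by simp
  qed
  finally show ?thesis by (simp add: sum_distrib_left)
qed

text \<open>Within a window the weights \<open>q ^ t\<close> vary at most by the factor
  \<open>R\<close>, so weighting the recursion and summing it costs only \<open>R\<close>. The first
  \<open>\<tau>\<close> indices have no predecessor a full window back and receive \<open>K\<close>
  instead; truncated subtraction starts their windows at 0. The term with \<open>\<gamma>\<close>
  repeats the left-hand side and is absorbed where the lemma is applied.\<close>

lemma weighted_sum_of_windowed_recursion_le:
  fixes V Z :: "nat \<Rightarrow> real"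
  assumes q: "1 \<le> q" "q ^ \<tau> \<le> R" and nonneg: "\<And>t. 0 \<le> V t" "\<And>t. 0 \<le> Z t" "0 \<le> c" "0 \<le> K" "0 \<le> \<gamma>"
    and late: "\<And>t. \<lbrakk>t < k; \<tau> \<le> t\<rbrakk> \<Longrightarrow> V t \<le> \<gamma> * V (t - \<tau>) + c * (\<Sum>i\<in>{t - \<tau>..<t}. Z i)"
    and early: "\<And>t. \<lbrakk>t < k; t < \<tau>\<rbrakk> \<Longrightarrow> V t \<le> K + c * (\<Sum>i\<in>{t - \<tau>..<t}. Z i)"
  shows "(\<Sum>t<k. q ^ t * V t) \<le>
    R * (\<gamma> * (\<Sum>t<k. q ^ t * V t) + real \<tau> * K + c * real \<tau> * (\<Sum>t<k. q ^ t * Z t))"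
proof -
  have pow: "q ^ t \<le> R * q ^ i" if "t - \<tau> \<le> i" "i \<le> t" for t i
  proof -
    have "q ^ t = q ^ (t - i) * q ^ i" using that by (simp flip: power_add)
    also have "q ^ (t - i) \<le> q ^ \<tau>" using q that by (intro power_increasing) auto
    finally show ?thesis using q by (meson mult_right_mono order_trans zero_le_power zero_le_one)
  qed
  have R: "1 \<le> R" using q one_le_power[of q \<tau>] by linarith
  let ?early = "\<lambda>t. if t < \<tau> then R * K else 0"
  let ?late = "\<lambda>t. if \<tau> \<le> t then R * \<gamma> * (q ^ (t - \<tau>) * V (t - \<tau>)) else 0"
  have "q ^ t * V t \<le> ?early t + ?late t + R * c * (\<Sum>i\<in>{t - \<tau>..<t}. q ^ i * Z i)" if "t < k" for t
  proof -
    have "q ^ t * (\<Sum>i\<in>{t - \<tau>..<t}. Z i) \<le> R * (\<Sum>i\<in>{t - \<tau>..<t}. q ^ i * Z i)"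
      unfolding sum_distrib_left
    proof (rule sum_mono)
      fix i assume "i \<in> {t - \<tau>..<t}"
      then show "q ^ t * Z i \<le> R * (q ^ i * Z i)"
        using mult_right_mono[OF pow[of t i] nonneg(2)[of i]] by (simp add: mult.assoc)
    qed
    then have "c * (q ^ t * (\<Sum>i\<in>{t - \<tau>..<t}. Z i)) \<le> c * (R * (\<Sum>i\<in>{t - \<tau>..<t}. q ^ i * Z i))"
      using \<open>0 \<le> c\<close> by (rule mult_left_mono)
    then have win: "q ^ t * (c * (\<Sum>i\<in>{t - \<tau>..<t}. Z i)) \<le> R * c * (\<Sum>i\<in>{t - \<tau>..<t}. q ^ i * Z i)"
      by (simp only: mult_ac)
    show ?thesis
    proof (cases "\<tau> \<le> t")
      case True
      have "q ^ t * V t \<le> q ^ t * (\<gamma> * V (t - \<tau>) + c * (\<Sum>i\<in>{t - \<tau>..<t}. Z i))"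
        using late[OF that True] q by (intro mult_left_mono) auto
      moreover have "q ^ t * (\<gamma> * V (t - \<tau>)) \<le> R * \<gamma> * (q ^ (t - \<tau>) * V (t - \<tau>))"
        using mult_right_mono[OF pow[of t "t - \<tau>"], of "\<gamma> * V (t - \<tau>)"] nonneg by (simp add: mult_ac)
      ultimately show ?thesis using win True by (simp add: distrib_left)
    next
      case False
      have "q ^ t * V t \<le> q ^ t * (K + c * (\<Sum>i\<in>{t - \<tau>..<t}. Z i))"
        using early[OF that] False q by (intro mult_left_mono) auto
      moreover have "q ^ t * K \<le> R * K"
        using pow[of t 0] False nonneg by (intro mult_right_mono) auto
      ultimately show ?thesis using win False by (simp add: distrib_left)
    qed
  qed
  then have "(\<Sum>t<k. q ^ t * V t) \<le>
      (\<Sum>t<k. ?early t + ?late t + R * c * (\<Sum>i\<in>{t - \<tau>..<t}. q ^ i * Z i))"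
    by (intro sum_mono) auto
  also have "\<dots> = (\<Sum>t<k. ?early t) + (\<Sum>t<k. ?late t)
      + R * c * (\<Sum>t<k. \<Sum>i\<in>{t - \<tau>..<t}. q ^ i * Z i)"
    by (simp add: sum.distrib sum_distrib_left)
  also have "(\<Sum>t<k. ?early t) \<le> (\<Sum>t<\<tau>. R * K)"
  proof -
    have "(\<Sum>t<k. ?early t) = (\<Sum>t\<in>{t. t < k \<and> t < \<tau>}. R * K)"
      by (rule sum.mono_neutral_cong_right) auto
    also have "\<dots> \<le> (\<Sum>t<\<tau>. R * K)"
      using R nonneg by (intro sum_mono2) auto
    finally show ?thesis .
  qed
  also have "(\<Sum>t<k. ?late t) \<le> R * \<gamma> * (\<Sum>t<k. q ^ t * V t)"
  proof -
    have "(\<Sum>t<k. ?late t) = (\<Sum>t\<in>{\<tau>..<k}. R * \<gamma> * (q ^ (t - \<tau>) * V (t - \<tau>)))"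
      by (rule sum.mono_neutral_cong_right) auto
    also have "\<dots> = (\<Sum>t<k - \<tau>. R * \<gamma> * (q ^ t * V t))"
      by (rule sum.reindex_bij_witness[of _ "\<lambda>t. t + \<tau>" "\<lambda>t. t - \<tau>"]) auto
    also have "\<dots> \<le> (\<Sum>t<k. R * \<gamma> * (q ^ t * V t))"
      using R q nonneg by (intro sum_mono2) auto
    finally show ?thesis by (simp add: sum_distrib_left)
  qed
  also have "R * c * (\<Sum>t<k. \<Sum>i\<in>{t - \<tau>..<t}. q ^ i * Z i) \<le> R * c * (real \<tau> * (\<Sum>t<k. q ^ t * Z t))"
    using q R nonneg by (intro mult_left_mono sum_windows_le) auto
  finally show ?thesis by (simp add: algebra_simps)
qed

text \<open>Discrete variation of constants. The disturbance \<open>b j\<close> enters with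
  \<open>r ^ (k - 1 - j)\<close>; factoring out \<open>r ^ k\<close> leaves the weight
  \<open>(1 / r) ^ j\<close> and one further \<open>1 / r\<close>, which becomes the factor
  \<open>1 - \<alpha> * \<mu> / 4\<close> in the denominator of the final bound.\<close>

lemma linear_recursion_le:
  fixes e b :: "nat \<Rightarrow> real"
  assumes "0 < r" and "\<And>j. j < k \<Longrightarrow> e (Suc j) \<le> r * e j + b j"
  shows "e k \<le> r ^ k * (e 0 + (1 / r) * (\<Sum>j<k. (1 / r) ^ j * b j))"
  using assms(2)
proof (induction k)
  case (Suc k)
  have "e (Suc k) \<le> r * e k + b k" by (simp add: Suc.prems)
  also have "r * e k \<le> r * (r ^ k * (e 0 + (1 / r) * (\<Sum>j<k. (1 / r) ^ j * b j)))"
    using Suc.IH Suc.prems \<open>0 < r\<close> by (intro mult_left_mono) auto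
  finally show ?case using \<open>0 < r\<close>
    by (simp add: distrib_left power_one_over)
qed simp

section \<open>The tracking recursion over a window\<close>

lemma matrix_window_self: "matrix_window Q s s = mat 1"
  by (cases s) auto

lemma norm_contraction_matrix_window:
  fixes Q :: "nat \<Rightarrow> real^'m::finite^'m"
  assumes "\<And>j z. norm (Q j *v z) \<le> norm z"
  shows "norm (matrix_window Q s (s + m) *v z) \<le> norm z"
proof (induction m)
  case 0
  then show ?case by (simp add: matrix_window_self)
next
  case (Suc m)
  have "norm (Q (s + m) *v (matrix_window Q s (s + m) *v z)) \<le> norm z"
    using assms Suc.IH order_trans by blast
  then show ?case by (simp add: matrix_vector_mul_assoc)
qed

text \<open>Each step subtracts \<open>\<alpha> *\<^sub>R Y\<close> from \<open>X\<close>; carried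
  to the end of the window, its homogeneous part is always the full window product applied to
  \<open>Y s\<close>, hence the factor \<open>real m\<close>. The forcing accumulates in
  \<open>B\<close>, and \<open>A\<close> accumulates the successive \<open>B\<close>, which explains
  the additional \<open>real m\<close> in its bound.\<close>

lemma tracking_window_decomposition:
  fixes Q :: "nat \<Rightarrow> real^'m::finite^'m"
  assumes contr: "\<And>j z. norm (Q j *v z) \<le> norm z"
    and X: "\<And>j. X (Suc j) = Q j *v (X j - \<alpha> *\<^sub>R Y j)"
    and Y: "\<And>j. Y (Suc j) = Q j *v Y j + G j"
  obtains A B where "X (s + m) = matrix_window Q s (s + m) *v (X s - (\<alpha> * real m) *\<^sub>R Y s) + \<alpha> *\<^sub>R A"
    and "Y (s + m) = matrix_window Q s (s + m) *v Y s + B"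
    and "norm A \<le> real m * (\<Sum>i\<in>{s..<s + m}. norm (G i))"
    and "norm B \<le> (\<Sum>i\<in>{s..<s + m}. norm (G i))"
proof (induction m arbitrary: thesis)
  case 0
  show ?case by (rule 0[of 0 0]) (simp_all add: matrix_window_self)
next
  case (Suc m)
  let ?W = "matrix_window Q s (s + m)" and ?g = "\<Sum>i\<in>{s..<s + m}. norm (G i)"
  obtain A B where A: "X (s + m) = ?W *v (X s - (\<alpha> * real m) *\<^sub>R Y s) + \<alpha> *\<^sub>R A"
    and B: "Y (s + m) = ?W *v Y s + B"
    and nA: "norm A \<le> real m * ?g" and nB: "norm B \<le> ?g"
    by (rule Suc.IH)
  show ?case
  \<comment> \<open>The new remainders are read off from one more step of the two
    recursions.\<close>
  proof (rule Suc.prems[of "Q (s + m) *v (A - B)" "Q (s + m) *v B + G (s + m)"])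
    show "X (s + Suc m) = matrix_window Q s (s + Suc m) *v (X s - (\<alpha> * real (Suc m)) *\<^sub>R Y s)
        + \<alpha> *\<^sub>R (Q (s + m) *v (A - B))"
      by (simp add: X A B matrix_vector_mul_assoc[symmetric] matrix_vector_mult_diff_distrib
          matrix_vector_right_distrib matrix_vector_mult_scaleR scaleR_add_right scaleR_diff_right
          scaleR_add_left distrib_left)
    show "Y (s + Suc m) = matrix_window Q s (s + Suc m) *v Y s + (Q (s + m) *v B + G (s + m))"
      using Y[of "s + m"] by (simp add: B matrix_vector_mul_assoc[symmetric] matrix_vector_right_distrib)
    have "norm (Q (s + m) *v (A - B)) \<le> norm A + norm B"
      using contr[of "s + m" "A - B"] norm_triangle_ineq4[of A B] by linarith
    also have "\<dots> \<le> real (Suc m) * ?g" using nA nB by (simp add: algebra_simps)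
    also have "\<dots> \<le> real (Suc m) * (\<Sum>i\<in>{s..<s + Suc m}. norm (G i))"
      by (intro mult_left_mono) auto
    finally show "norm (Q (s + m) *v (A - B)) \<le> real (Suc m) * (\<Sum>i\<in>{s..<s + Suc m}. norm (G i))" .
    have "norm (Q (s + m) *v B + G (s + m)) \<le> norm B + norm (G (s + m))"
      using contr[of "s + m" B] norm_triangle_ineq[of "Q (s + m) *v B" "G (s + m)"] by linarith
    then show "norm (Q (s + m) *v B + G (s + m)) \<le> (\<Sum>i\<in>{s..<s + Suc m}. norm (G i))"
      using nB by simp
  qed
qed

text \<open>Contraction by \<open>\<sigma>\<close> is asked only of the two vectors on which the
  window acts, because it will be available for vectors of mean zero. With
  \<open>\<sigma> = 1\<close> the same estimate serves the shorter windows that start at index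
  0.\<close>

lemma tracking_window_bound:
  fixes Q :: "nat \<Rightarrow> real^'m::finite^'m"
  assumes contr: "\<And>j z. norm (Q j *v z) \<le> norm z"
    and X: "\<And>j. X (Suc j) = Q j *v (X j - \<alpha> *\<^sub>R Y j)"
    and Y: "\<And>j. Y (Suc j) = Q j *v Y j + G j"
    and wX: "norm (matrix_window Q s (s + m) *v (X s - (\<alpha> * real m) *\<^sub>R Y s))
        \<le> \<sigma> * norm (X s - (\<alpha> * real m) *\<^sub>R Y s)"
    and wY: "norm (matrix_window Q s (s + m) *v Y s) \<le> \<sigma> * norm (Y s)"
  shows "(norm (X (s + m)))\<^sup>2 + \<alpha>\<^sup>2 * (norm (Y (s + m)))\<^sup>2
    \<le> 4 * (1 + (real m)\<^sup>2) * \<sigma>\<^sup>2 * ((norm (X s))\<^sup>2 + \<alpha>\<^sup>2 * (norm (Y s))\<^sup>2)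
      + 2 * \<alpha>\<^sup>2 * (1 + (real m)\<^sup>2) * real m * (\<Sum>i\<in>{s..<s + m}. (norm (G i))\<^sup>2)"
proof -
  let ?W = "matrix_window Q s (s + m)" and ?g = "\<Sum>i\<in>{s..<s + m}. norm (G i)"
  obtain A B where A: "X (s + m) = ?W *v (X s - (\<alpha> * real m) *\<^sub>R Y s) + \<alpha> *\<^sub>R A"
    and B: "Y (s + m) = ?W *v Y s + B"
    and nA: "norm A \<le> real m * ?g" and nB: "norm B \<le> ?g"
    by (rule tracking_window_decomposition[where Q = Q and X = X and Y = Y and G = G and \<alpha> = \<alpha>,
          OF contr X Y])
  have nA2: "(norm A)\<^sup>2 \<le> (real m)\<^sup>2 * ?g\<^sup>2"
    using power_mono[OF nA, of 2] by (simp add: power_mult_distrib)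
  have nB2: "(norm B)\<^sup>2 \<le> ?g\<^sup>2" using power_mono[OF nB, of 2] by simp
  have g: "?g\<^sup>2 \<le> real m * (\<Sum>i\<in>{s..<s + m}. (norm (G i))\<^sup>2)"
    using sum_squared_le_sum_of_squares[of "\<lambda>i. norm (G i)" "{s..<s + m}"] by (simp add: mult.commute)
  have "(norm (?W *v (X s - (\<alpha> * real m) *\<^sub>R Y s)))\<^sup>2 \<le> \<sigma>\<^sup>2 * (norm (X s - (\<alpha> * real m) *\<^sub>R Y s))\<^sup>2"
    using power_mono[OF wX, of 2] by (simp add: power_mult_distrib)
  also have "(norm (X s - (\<alpha> * real m) *\<^sub>R Y s))\<^sup>2 \<le> 2 * (norm (X s))\<^sup>2 + 2 * (\<alpha>\<^sup>2 * (real m)\<^sup>2 * (norm (Y s))\<^sup>2)"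
    using norm_add_squared_le[of "X s" "- ((\<alpha> * real m) *\<^sub>R Y s)"] by (simp add: power_mult_distrib)
  finally have wX2: "(norm (?W *v (X s - (\<alpha> * real m) *\<^sub>R Y s)))\<^sup>2
      \<le> \<sigma>\<^sup>2 * (2 * (norm (X s))\<^sup>2 + 2 * (\<alpha>\<^sup>2 * (real m)\<^sup>2 * (norm (Y s))\<^sup>2))"
    by (simp add: mult_left_mono)
  have wY2: "(norm (?W *v Y s))\<^sup>2 \<le> \<sigma>\<^sup>2 * (norm (Y s))\<^sup>2"
    using power_mono[OF wY, of 2] by (simp add: power_mult_distrib)
  have "(norm (X (s + m)))\<^sup>2 \<le> 2 * (\<sigma>\<^sup>2 * (2 * (norm (X s))\<^sup>2 + 2 * (\<alpha>\<^sup>2 * (real m)\<^sup>2 * (norm (Y s))\<^sup>2)))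
      + 2 * \<alpha>\<^sup>2 * ((real m)\<^sup>2 * ?g\<^sup>2)"
    using norm_add_squared_le[of "?W *v (X s - (\<alpha> * real m) *\<^sub>R Y s)" "\<alpha> *\<^sub>R A"] wX2
      mult_left_mono[OF nA2, of "\<alpha>\<^sup>2"] by (simp add: A power_mult_distrib)
  moreover have "\<alpha>\<^sup>2 * (norm (Y (s + m)))\<^sup>2 \<le> \<alpha>\<^sup>2 * (2 * (\<sigma>\<^sup>2 * (norm (Y s))\<^sup>2) + 2 * ?g\<^sup>2)"
    using norm_add_squared_le[of "?W *v Y s" B] wY2 nB2 by (intro mult_left_mono) (auto simp: B)
  \<comment> \<open>An exact identity: the target exceeds the sum of the two bounds by the last
    summand, which is nonnegative.\<close>
  moreover have "4 * (1 + (real m)\<^sup>2) * \<sigma>\<^sup>2 * ((norm (X s))\<^sup>2 + \<alpha>\<^sup>2 * (norm (Y s))\<^sup>2) + 2 * \<alpha>\<^sup>2 * (1 + (real m)\<^sup>2) * ?g\<^sup>2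
      = 2 * (\<sigma>\<^sup>2 * (2 * (norm (X s))\<^sup>2 + 2 * (\<alpha>\<^sup>2 * (real m)\<^sup>2 * (norm (Y s))\<^sup>2))) + 2 * \<alpha>\<^sup>2 * ((real m)\<^sup>2 * ?g\<^sup>2)
        + \<alpha>\<^sup>2 * (2 * (\<sigma>\<^sup>2 * (norm (Y s))\<^sup>2) + 2 * ?g\<^sup>2)
        + \<sigma>\<^sup>2 * (4 * (real m)\<^sup>2 * (norm (X s))\<^sup>2 + 2 * \<alpha>\<^sup>2 * (norm (Y s))\<^sup>2)"
    by (simp add: algebra_simps)
  moreover have "0 \<le> \<sigma>\<^sup>2 * (4 * (real m)\<^sup>2 * (norm (X s))\<^sup>2 + 2 * \<alpha>\<^sup>2 * (norm (Y s))\<^sup>2)"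
    by simp
  ultimately have "(norm (X (s + m)))\<^sup>2 + \<alpha>\<^sup>2 * (norm (Y (s + m)))\<^sup>2
    \<le> 4 * (1 + (real m)\<^sup>2) * \<sigma>\<^sup>2 * ((norm (X s))\<^sup>2 + \<alpha>\<^sup>2 * (norm (Y s))\<^sup>2) + 2 * \<alpha>\<^sup>2 * (1 + (real m)\<^sup>2) * ?g\<^sup>2"
    by linarith
  also have "2 * \<alpha>\<^sup>2 * (1 + (real m)\<^sup>2) * ?g\<^sup>2
      \<le> 2 * \<alpha>\<^sup>2 * (1 + (real m)\<^sup>2) * (real m * (\<Sum>i\<in>{s..<s + m}. (norm (G i))\<^sup>2))"
    by (rule mult_left_mono[OF g]) simp
  finally show ?thesis by (simp add: mult.assoc)
qed

section \<open>The gradient step of the mean iterate\<close>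

text \<open>Expand the square. The cross term is controlled by
  \<open>inner_inexact_gradient_ge\<close> at every \<open>z i\<close>, the squared step by
  \<open>norm_tracked_gradient_le\<close>.\<close>

lemma inexact_gradient_step:
  fixes f :: "'n::finite \<Rightarrow> real^'d::finite \<Rightarrow> real"
  assumes smooth: "\<And>i. L_smooth L (f i)" and conv: "\<And>i. strongly_convex \<mu> (f i)"
    and min: "\<And>v. (\<Sum>i\<in>UNIV. f i w) \<le> (\<Sum>i\<in>UNIV. f i v)"
    and "0 < L" "0 < \<alpha>" and small: "\<alpha> * L \<le> 1 / 8"
    and u: "u = node_mean z" and g: "g = node_mean (\<lambda>i. gradient (f i) (z i))"
  shows "real CARD('n) * (norm (u - \<alpha> *\<^sub>R g - w))\<^sup>2
    \<le> (1 - \<alpha> * \<mu>) * (real CARD('n) * (norm (u - w))\<^sup>2)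
      - \<alpha> * (\<Sum>i\<in>UNIV. f i u - f i w) + 3 * \<alpha> * L * (\<Sum>i\<in>UNIV. (norm (z i - u))\<^sup>2)"
proof -
  let ?n = "real CARD('n)"
  define D where "D = (\<Sum>i\<in>UNIV. f i u - f i w)"
  define S where "S = (\<Sum>i\<in>UNIV. (norm (z i - u))\<^sup>2)"
  have "0 \<le> D" using min[of u] by (simp add: D_def sum_subtractf)
  have "0 \<le> S" by (simp add: S_def sum_nonneg)
  have "0 < \<mu>" using conv by (simp add: strongly_convex_def)
  \<comment> \<open>Strong convexity supplies the distances of the points \<open>z i\<close> from
    \<open>w\<close>; Jensen's inequality passes to the distance of their mean
    \<open>u\<close>.\<close>
  have "node_mean (\<lambda>i. z i - w) = u - w" by (simp add: node_mean_diff node_mean_const u)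
  then have "\<mu> / 2 * (?n * (norm (u - w))\<^sup>2) \<le> \<mu> / 2 * (\<Sum>i\<in>UNIV. (norm (z i - w))\<^sup>2)"
    using norm_node_mean_squared_le[of "\<lambda>i. z i - w"] \<open>0 < \<mu>\<close> by (intro mult_left_mono) auto
  then have "D - L * S + \<mu> / 2 * (?n * (norm (u - w))\<^sup>2)
      \<le> D - L * S + \<mu> / 2 * (\<Sum>i\<in>UNIV. (norm (z i - w))\<^sup>2)" by simp
  also have "\<dots> = (\<Sum>i\<in>UNIV. f i u - f i w - L * (norm (z i - u))\<^sup>2 + \<mu> / 2 * (norm (z i - w))\<^sup>2)"
    by (simp add: D_def S_def sum.distrib sum_subtractf sum_distrib_left)
  also have "\<dots> \<le> (\<Sum>i\<in>UNIV. gradient (f i) (z i) \<bullet> (u - w))"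
    by (intro sum_mono inner_inexact_gradient_ge[OF smooth conv])
  also have "\<dots> = ?n * (g \<bullet> (u - w))" by (simp add: g inner_node_mean)
  finally have "2 * \<alpha> * (D - L * S + \<mu> / 2 * (?n * (norm (u - w))\<^sup>2)) \<le> 2 * \<alpha> * (?n * (g \<bullet> (u - w)))"
    using \<open>0 < \<alpha>\<close> by (intro mult_left_mono) auto
  moreover have "\<alpha>\<^sup>2 * (?n * (norm g)\<^sup>2) \<le> \<alpha>\<^sup>2 * (8 * L * D + 2 * L\<^sup>2 * S)"
    unfolding g D_def S_def
    by (intro mult_left_mono norm_tracked_gradient_le[OF smooth conv min \<open>0 < L\<close>]) simp
  moreover have "?n * (norm (u - \<alpha> *\<^sub>R g - w))\<^sup>2
      = ?n * (norm (u - w))\<^sup>2 - 2 * \<alpha> * (?n * (g \<bullet> (u - w))) + \<alpha>\<^sup>2 * (?n * (norm g)\<^sup>2)"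
    unfolding power2_norm_eq_inner
    by (simp add: algebra_simps inner_commute power2_eq_square)
  \<comment> \<open>Of the gain \<open>2 * \<alpha> * D\<close> from the cross term, one half pays
    for the gap part of the squared step. The error \<open>S\<close> collects
    \<open>2 + 1 = 3\<close> multiples of \<open>\<alpha> * L\<close>.\<close>
  moreover have "\<alpha> * D * (8 * (\<alpha> * L)) \<le> \<alpha> * D * 1"
    using small \<open>0 < \<alpha>\<close> \<open>0 \<le> D\<close> by (intro mult_left_mono) auto
  moreover have "\<alpha> * L * S * (2 * (\<alpha> * L)) \<le> \<alpha> * L * S * 1"
    using small \<open>0 < \<alpha>\<close> \<open>0 < L\<close> \<open>0 \<le> S\<close> by (intro mult_left_mono) auto
  ultimately have "?n * (norm (u - \<alpha> *\<^sub>R g - w))\<^sup>2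
      \<le> (1 - \<alpha> * \<mu>) * (?n * (norm (u - w))\<^sup>2) - \<alpha> * D + 3 * \<alpha> * L * S"
    by (simp add: algebra_simps power2_eq_square)
  then show ?thesis by (simp add: D_def S_def)
qed

text \<open>The index range of the maximum ends at \<open>max \<tau>' k\<close>, so it contains
  \<open>\<tau>'\<close> even when \<open>k < \<tau>'\<close> and the maximum is never taken over an
  empty set.\<close>

theorem theorem2:
  fixes E :: "('n::finite \<times> 'n) set"
    and f :: "'n \<Rightarrow> real^('d::finite) \<Rightarrow> real"
    and L \<mu> \<alpha> \<rho>' :: real
    and xstar :: "real^'d"
    and Q Qhat :: "nat \<Rightarrow> real^'n^'n"
    and QQ QQhat :: "nat \<Rightarrow> real^('n \<times> 'd)^('n \<times> 'd)"
    and x y :: "nat \<Rightarrow> 'n \<Rightarrow> real^'d"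
    and \<tau> \<tau>' k :: nat
  assumes "sym E" and "connected_graph E"
    and "\<And>i. L_smooth L (f i)" and "\<And>i. strongly_convex \<mu> (f i)"
    and "is_arg_min (\<lambda>u. (1 / real CARD('n)) * (\<Sum>i\<in>UNIV. f i u)) (\<lambda>_. True) xstar"
    and "\<tau> \<ge> 1"
    and "\<And>m. pruned_mixing_matrix E (Q m)" and "\<And>m. pruned_mixing_matrix E (Qhat m)"
    and "\<And>j. QQ j = kronecker (Q (j div \<tau>)) (mat 1)"
    and "\<And>j. QQhat j = kronecker (Qhat (j div \<tau>)) (mat 1)"
    and "\<And>j. doubly_stochastic (QQ j)" and "\<And>j. QQhat j = QQ j"
    and "\<And>j. stack (x (Suc j)) = QQ j *v (stack (x j) - \<alpha> *\<^sub>R stack (y j))"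
    and "\<And>j. stack (y (Suc j)) = QQhat j *v stack (y j)
            + stack (\<lambda>i. gradient (f i) (x (Suc j) i)) - stack (\<lambda>i. gradient (f i) (x j i))"
    and "\<And>i. y 0 i = gradient (f i) (x 0 i)"
    and "\<tau>' \<ge> 1"
    and "\<rho>' = 2 * (1 + (real \<tau>')\<^sup>2) *
          (MAX t\<in>{\<tau>'..max \<tau>' k}. (spectral_norm (matrix_window QQ (t - \<tau>') t - averaging_matrix))\<^sup>2)"
    and "\<rho>' < 1 / 4"
    and "0 < \<alpha>" and "\<alpha> < min 1 (sqrt \<rho>' / (58 * L * (real \<tau>')\<^sup>2))"
  shows "(norm (node_mean (x k) - xstar))\<^sup>2 \<le>
    (1 - \<alpha> * \<mu> / 4) ^ k *
      ((norm (node_mean (x 0) - xstar))\<^sup>2 +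
       1000 * L * (1 + (real \<tau>')\<^sup>2) / (\<mu> * real CARD('n) * (1 - \<alpha> * \<mu> / 4)) *
         ((norm (stack (x 0) - stack (\<lambda>_. node_mean (x 0))))\<^sup>2 +
          \<alpha>\<^sup>2 * (norm (stack (y 0) - stack (\<lambda>_. node_mean (y 0))))\<^sup>2))"
  proof -
  note smooth = assms(3) and conv = assms(4) and argmin = assms(5) and QQ = assms(9)
    and ds = assms(11) and xrec = assms(13) and y0 = assms(15) and \<tau>'_ge = assms(16)
    and \<rho>'_def = assms(17) and \<rho>'_lt = assms(18) and \<alpha>_pos = assms(19) and \<alpha>_lt = assms(20)
  have yrec: "stack (y (Suc j)) = QQ j *v stack (y j)
      + (stack (\<lambda>i. gradient (f i) (x (Suc j) i)) - stack (\<lambda>i. gradient (f i) (x j i)))" for j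
    using assms(12,14) by (simp add: algebra_simps)
  let ?n = "real CARD('n)" and ?T = "real \<tau>'"
  define J :: "real^('n \<times> 'd)^('n \<times> 'd)" where "J = averaging_matrix"
  define gr where "gr j = (\<lambda>i. gradient (f i) (x j i))" for j
  define X where "X j = stack (x j) - stack (\<lambda>_. node_mean (x j))" for j
  define Y where "Y j = stack (y j) - stack (\<lambda>_. node_mean (y j))" for j
  define V where "V j = (norm (X j))\<^sup>2 + \<alpha>\<^sup>2 * (norm (Y j))\<^sup>2" for j
  define D where "D j = (\<Sum>i\<in>UNIV. f i (node_mean (x j)) - f i xstar)" for j
  define G where "G j = (stack (gr (Suc j)) - stack (gr j)) - J *v (stack (gr (Suc j)) - stack (gr j))" for j
  define r where "r = 1 - \<alpha> * \<mu> / 4"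

  \<comment> \<open>Signs and sizes of the parameters\<close>
  have min: "(\<Sum>i\<in>UNIV. f i xstar) \<le> (\<Sum>i\<in>UNIV. f i v)" for v
    using argmin by (auto simp: is_arg_min_def not_less divide_le_cancel)
  have D_nonneg: "0 \<le> D j" for j
    using min[of "node_mean (x j)"] by (simp add: D_def sum_subtractf)
  have V_nonneg: "0 \<le> V j" for j by (simp add: V_def)
  have lips: "norm (gradient (f i) u - gradient (f i) v) \<le> L * norm (u - v)" for i u v
    using smooth[of i] by (auto simp: L_smooth_def lipschitz_on_def dist_norm)
  have L_nonneg: "0 \<le> L" using smooth by (auto simp: L_smooth_def lipschitz_on_def)
  \<comment> \<open>Division by zero yields 0, so \<open>L = 0\<close> would turn the step size
    bound into \<open>\<alpha> < 0\<close>.\<close>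
  have L_pos: "0 < L"
  proof (rule ccontr)
    assume "\<not> 0 < L"
    then have "L = 0" using L_nonneg by simp
    then show False using \<alpha>_pos \<alpha>_lt by simp
  qed
  have \<mu>_pos: "0 < \<mu>" using conv by (simp add: strongly_convex_def)
  \<comment> \<open>Compare the two quadratic bounds between 0 and a unit vector. The factor 2 stems
    from the coefficient \<open>L\<close>, rather than \<open>L / 2\<close>, in the upper
    bound.\<close>
  have \<mu>_le: "\<mu> \<le> 2 * L"
  proof -
    fix i
    obtain b :: "real^'d" where b: "b \<in> Basis" using nonempty_Basis by blast
    have "f i b \<ge> f i 0 + gradient (f i) 0 \<bullet> (b - 0) + \<mu> / 2 * (norm (b - 0))\<^sup>2"
      using conv[of i] unfolding strongly_convex_def by blast
    moreover have "f i b \<le> f i 0 + gradient (f i) 0 \<bullet> (b - 0) + L * (norm (b - 0))\<^sup>2"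
      by (rule strongly_convex_smooth_upper[OF smooth conv])
    ultimately show ?thesis using b by simp
  qed
  have T_ge: "1 \<le> ?T" using \<tau>'_ge by simp
  \<comment> \<open>All later smallness conditions are reduced to \<open>\<beta>\<close>. The step
    size bound gives \<open>58 * \<beta> < sqrt \<rho>' < 1 / 2\<close>, whence
    \<open>1 / 116\<close>.\<close>
  define \<beta> where "\<beta> = \<alpha> * L * ?T\<^sup>2"
  have \<beta>_pos: "0 < \<beta>" using \<alpha>_pos L_pos T_ge by (simp add: \<beta>_def)
  have \<beta>_lt: "\<beta> < 1 / 116"
  proof -
    have "sqrt \<rho>' < sqrt (1 / 4)" using \<rho>'_lt by (rule real_sqrt_less_mono)
    then have "sqrt \<rho>' < 1 / 2" by (simp add: real_sqrt_divide)
    moreover have "\<alpha> * (58 * L * ?T\<^sup>2) < sqrt \<rho>'"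
      using \<alpha>_lt L_pos T_ge by (simp add: pos_less_divide_eq)
    ultimately show ?thesis by (simp add: \<beta>_def mult_ac)
  qed
  have aLT: "\<alpha> * L * ?T \<le> \<beta>"
    using T_ge \<alpha>_pos L_pos by (simp add: \<beta>_def power2_eq_square)
  have aL: "\<alpha> * L \<le> \<alpha> * L * ?T"
    using T_ge \<alpha>_pos L_pos by simp
  have aL_pos: "0 < \<alpha> * L" using \<alpha>_pos L_pos by simp
  have amuT: "\<alpha> * \<mu> * ?T \<le> 2 * \<beta>"
  proof -
    have "\<alpha> * ?T * \<mu> \<le> \<alpha> * ?T * (2 * L)"
      using \<mu>_le \<alpha>_pos by (intro mult_left_mono) auto
    then show ?thesis using aLT by (simp add: mult_ac)
  qed
  have amu: "\<alpha> * \<mu> \<le> \<alpha> * \<mu> * ?T" using T_ge \<alpha>_pos \<mu>_pos by simp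
  have amu_pos: "0 < \<alpha> * \<mu>" using \<alpha>_pos \<mu>_pos by simp

  \<comment> \<open>Recursions for the deviations and the means\<close>
  have QJ: "QQ j ** J = J" and JQ: "J ** QQ j = J" for j
    using ds[of j] averaging_matrix_absorbs doubly_stochastic_kronecker_mat1D
    unfolding QQ J_def by blast+
  have contr: "norm (QQ j *v z) \<le> norm z" for j z
    using ds by (rule norm_contraction_doubly_stochastic)
  have J_stack: "J *v stack w = stack (\<lambda>_. node_mean w)" for w
    by (simp add: J_def averaging_matrix_stack)
  have X_eq: "X j = stack (x j) - J *v stack (x j)" and Y_eq: "Y j = stack (y j) - J *v stack (y j)" for j
    by (simp_all add: X_def Y_def J_stack)
  have JJ: "J *v (J *v stack w) = J *v stack w" for w :: "'n \<Rightarrow> real^'d"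
    by (simp add: J_stack node_mean_const)
  have JX: "J *v X j = 0" and JY: "J *v Y j = 0" for j
    by (simp_all add: X_eq Y_eq matrix_vector_mult_diff_distrib JJ)
  have QJv: "QQ j *v (J *v v) = J *v v" and JQv: "J *v (QQ j *v v) = J *v v" for j v
    by (simp_all add: matrix_vector_mul_assoc QJ JQ)
  have Xrec: "X (Suc j) = QQ j *v (X j - \<alpha> *\<^sub>R Y j)" for j
    by (simp add: X_eq Y_eq xrec JQv QJv matrix_vector_mult_diff_distrib matrix_vector_mult_scaleR
        scaleR_diff_right)
  have Yrec: "Y (Suc j) = QQ j *v Y j + G j" for j
    by (simp add: Y_eq yrec JQv QJv matrix_vector_mult_diff_distrib matrix_vector_right_distrib
        G_def gr_def)

  have mean_x: "node_mean (x (Suc j)) = node_mean (x j) - \<alpha> *\<^sub>R node_mean (y j)" for j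
  proof -
    have "J *v stack (x (Suc j)) = J *v (stack (x j) - \<alpha> *\<^sub>R stack (y j))"
      by (simp only: xrec JQv)
    then have "stack (\<lambda>_ :: 'n. node_mean (x (Suc j)))
        = stack (\<lambda>_ :: 'n. node_mean (x j) - \<alpha> *\<^sub>R node_mean (y j))"
      by (simp add: J_stack matrix_vector_mult_diff_distrib matrix_vector_mult_scaleR stack_simps)
    then show ?thesis by (simp add: stack_inject fun_eq_iff)
  qed
  \<comment> \<open>The gradient tracking invariant: mixing preserves the mean and the gradient
    increments telescope, starting from the choice of \<open>y 0\<close>.\<close>
  have mean_y: "node_mean (y j) = node_mean (gr j)" for j
  proof (induction j)
    case 0
    have "y 0 = gr 0" by (simp add: fun_eq_iff y0 gr_def)
    then show ?case by simp
  next
    case (Suc j)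
    have "J *v stack (y (Suc j)) = J *v stack (y j) + (J *v stack (gr (Suc j)) - J *v stack (gr j))"
      by (simp add: yrec JQv matrix_vector_mult_diff_distrib matrix_vector_right_distrib gr_def)
    then have "stack (\<lambda>_ :: 'n. node_mean (y (Suc j)))
        = stack (\<lambda>_ :: 'n. node_mean (y j) + (node_mean (gr (Suc j)) - node_mean (gr j)))"
      by (simp add: J_stack stack_simps)
    then show ?case by (simp add: stack_inject fun_eq_iff Suc.IH)
  qed

  have norm_X: "(norm (X j))\<^sup>2 = (\<Sum>i\<in>UNIV. (norm (x j i - node_mean (x j)))\<^sup>2)" for j
    by (simp add: X_def norm_stack_squared flip: stack_simps)
  have X_le_V: "(norm (X j))\<^sup>2 \<le> V j" for j by (simp add: V_def)
  \<comment> \<open>The factor \<open>1 - \<alpha> * \<mu>\<close> is weakened to \<open>r\<close>,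
    whose inverse powers are the weights used below.\<close>
  have step: "(norm (node_mean (x (Suc j)) - xstar))\<^sup>2
      \<le> r * (norm (node_mean (x j) - xstar))\<^sup>2 + (3 * \<alpha> * L * V j - \<alpha> * D j) / ?n" for j
  proof -
    have "?n * (norm (node_mean (x (Suc j)) - xstar))\<^sup>2
      \<le> (1 - \<alpha> * \<mu>) * (?n * (norm (node_mean (x j) - xstar))\<^sup>2) - \<alpha> * D j + 3 * \<alpha> * L * (norm (X j))\<^sup>2"
      unfolding mean_x mean_y D_def norm_X gr_def
      using aL aLT \<beta>_lt by (intro inexact_gradient_step[OF smooth conv min L_pos \<alpha>_pos]) auto
    also have "\<dots> \<le> r * (?n * (norm (node_mean (x j) - xstar))\<^sup>2) - \<alpha> * D j + 3 * \<alpha> * L * V j"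
      using X_le_V[of j] L_pos \<alpha>_pos \<mu>_pos D_nonneg
      by (intro add_mono diff_mono mult_right_mono mult_left_mono) (auto simp: r_def)
    finally show ?thesis by (simp add: field_simps)
  qed

  \<comment> \<open>Gradient increments\<close>
  \<comment> \<open>\<open>Z j\<close> bounds the squared displacement of the stacked iterate. Here
    \<open>13 = 12 + 1\<close>: 12 comes from \<open>3 * 2^2\<close> in front of the squared norm of
    \<open>X j\<close>, and 1 covers \<open>6 * (\<alpha> * L)^2\<close>; \<open>24 = 3 * 8\<close>
    comes from the mean step.\<close>
  define Z where "Z j = 13 * V j + 24 * \<alpha>\<^sup>2 * L * D j" for j
  have Z_nonneg: "0 \<le> Z j" for j
    using V_nonneg D_nonneg L_nonneg by (simp add: Z_def)
  have G_le: "(norm (G j))\<^sup>2 \<le> L\<^sup>2 * Z j" for j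
  proof -
    have three: "(a + b + c)\<^sup>2 \<le> 3 * (a\<^sup>2 + b\<^sup>2 + c\<^sup>2)" for a b c :: real
      using zero_le_power2[of "a - b"] zero_le_power2[of "b - c"] zero_le_power2[of "a - c"]
      by (simp add: power2_eq_square algebra_simps)
    let ?m = "stack (\<lambda>_ :: 'n. node_mean (y j))"
    \<comment> \<open>The displacement is the change of the deviation minus the step of the mean;
      the new deviation is bounded through the contraction by \<open>QQ j\<close>.\<close>
    have "stack (x (Suc j)) - stack (x j) = X (Suc j) - X j - \<alpha> *\<^sub>R ?m"
      by (simp add: X_def mean_x stack_simps)
    moreover have "norm (X (Suc j)) \<le> norm (X j) + \<alpha> * norm (Y j)"
      unfolding Xrec using \<alpha>_pos contr[of j "X j - \<alpha> *\<^sub>R Y j"] norm_triangle_ineq4[of "X j" "\<alpha> *\<^sub>R Y j"]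
      by simp
    ultimately have "norm (stack (x (Suc j)) - stack (x j)) \<le> 2 * norm (X j) + \<alpha> * norm (Y j) + \<alpha> * norm ?m"
      using \<alpha>_pos norm_triangle_ineq4[of "X (Suc j) - X j" "\<alpha> *\<^sub>R ?m"] norm_triangle_ineq4[of "X (Suc j)" "X j"]
      by simp
    then have "(norm (stack (x (Suc j)) - stack (x j)))\<^sup>2
        \<le> (2 * norm (X j) + \<alpha> * norm (Y j) + \<alpha> * norm ?m)\<^sup>2"
      by (rule power_mono) simp
    also have "\<dots> \<le> 3 * ((2 * norm (X j))\<^sup>2 + (\<alpha> * norm (Y j))\<^sup>2 + (\<alpha> * norm ?m)\<^sup>2)"
      by (rule three)
    also have "\<dots> \<le> 12 * V j + 3 * (\<alpha>\<^sup>2 * (norm ?m)\<^sup>2)"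
      by (simp add: V_def power_mult_distrib)
    also have "\<alpha>\<^sup>2 * (norm ?m)\<^sup>2 \<le> \<alpha>\<^sup>2 * (8 * L * D j + 2 * L\<^sup>2 * V j)"
    proof (rule mult_left_mono)
      have "(norm ?m)\<^sup>2 = ?n * (norm (node_mean (gr j)))\<^sup>2"
        by (simp add: norm_stack_squared mean_y)
      also have "\<dots> \<le> 8 * L * D j + 2 * L\<^sup>2 * (norm (X j))\<^sup>2"
        unfolding D_def norm_X gr_def by (rule norm_tracked_gradient_le[OF smooth conv min L_pos])
      also have "\<dots> \<le> 8 * L * D j + 2 * L\<^sup>2 * V j" by (simp add: X_le_V mult_left_mono)
      finally show "(norm ?m)\<^sup>2 \<le> 8 * L * D j + 2 * L\<^sup>2 * V j" .
    qed simp
    also have "3 * (\<alpha>\<^sup>2 * (8 * L * D j + 2 * L\<^sup>2 * V j)) \<le> V j + 24 * \<alpha>\<^sup>2 * L * D j"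
    proof -
      have "(\<alpha> * L)\<^sup>2 \<le> (1 / 116)\<^sup>2" using aL aLT \<beta>_lt aL_pos by (intro power_mono) auto
      then have "6 * (\<alpha> * L)\<^sup>2 * V j \<le> 1 * V j"
        using V_nonneg by (intro mult_right_mono) (auto simp: power2_eq_square)
      then show ?thesis by (simp add: algebra_simps power_mult_distrib)
    qed
    finally have dx: "(norm (stack (x (Suc j)) - stack (x j)))\<^sup>2 \<le> Z j" by (simp add: Z_def)
    have "norm (G j) \<le> norm (stack (\<lambda>i. gr (Suc j) i - gr j i))"
      using norm_diff_node_mean_le[of "\<lambda>i. gr (Suc j) i - gr j i"]
      by (simp add: G_def J_stack flip: stack_simps)
    then have "(norm (G j))\<^sup>2 \<le> (norm (stack (\<lambda>i. gr (Suc j) i - gr j i)))\<^sup>2" by (simp add: power_mono)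
    also have "\<dots> \<le> (\<Sum>i\<in>UNIV. (L * norm (x (Suc j) i - x j i))\<^sup>2)"
      unfolding norm_stack_squared gr_def by (intro sum_mono power_mono lips) simp
    also have "\<dots> = L\<^sup>2 * (norm (stack (\<lambda>i. x (Suc j) i - x j i)))\<^sup>2"
      by (simp add: norm_stack_squared power_mult_distrib sum_distrib_left)
    also have "\<dots> \<le> L\<^sup>2 * Z j" using dx by (intro mult_left_mono) (auto simp: stack_simps)
    finally show ?thesis .
  qed

  \<comment> \<open>Contraction over a window\<close>
  \<comment> \<open>For \<open>m \<le> \<tau>'\<close> the factor \<open>2 * (1 + m^2) * m\<close>
    is at most \<open>4 * \<tau>'^3\<close>, and \<open>G_le\<close> contributes \<open>L^2\<close>.
    One more factor \<open>\<tau>'\<close> turns \<open>c\<close> into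
    \<open>4 * \<beta>^2\<close>.\<close>
  define c where "c = 4 * \<alpha>\<^sup>2 * L\<^sup>2 * ?T ^ 3"
  have c_nonneg: "0 \<le> c" by (simp add: c_def)
  have forcing: "2 * \<alpha>\<^sup>2 * (1 + (real m)\<^sup>2) * real m * (\<Sum>i\<in>I. (norm (G i))\<^sup>2) \<le> c * (\<Sum>i\<in>I. Z i)"
    if "m \<le> \<tau>'" for m and I :: "nat set"
  proof -
    have "(1 + (real m)\<^sup>2) * real m \<le> (2 * ?T\<^sup>2) * ?T"
    proof (rule mult_mono)
      have "(real m)\<^sup>2 \<le> ?T\<^sup>2" using that by (intro power_mono) auto
      moreover have "1 \<le> ?T\<^sup>2" using T_ge by (simp add: one_le_power)
      ultimately show "1 + (real m)\<^sup>2 \<le> 2 * ?T\<^sup>2" by linarith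
    qed (use that in auto)
    then have "2 * \<alpha>\<^sup>2 * ((1 + (real m)\<^sup>2) * real m) \<le> 2 * \<alpha>\<^sup>2 * (2 * ?T\<^sup>2 * ?T)"
      by (intro mult_left_mono) auto
    moreover have "(\<Sum>i\<in>I. (norm (G i))\<^sup>2) \<le> L\<^sup>2 * (\<Sum>i\<in>I. Z i)"
      unfolding sum_distrib_left by (rule sum_mono) (rule G_le)
    ultimately have "2 * \<alpha>\<^sup>2 * ((1 + (real m)\<^sup>2) * real m) * (\<Sum>i\<in>I. (norm (G i))\<^sup>2)
        \<le> 2 * \<alpha>\<^sup>2 * (2 * ?T\<^sup>2 * ?T) * (L\<^sup>2 * (\<Sum>i\<in>I. Z i))"
      by (rule mult_mono) (simp_all add: sum_nonneg)
    then show ?thesis by (simp add: c_def power2_eq_square power3_eq_cube mult_ac)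
  qed

  have late: "V t \<le> 1 / 2 * V (t - \<tau>') + c * (\<Sum>i\<in>{t - \<tau>'..<t}. Z i)" if "t < k" "\<tau>' \<le> t" for t
  proof -
    define s where "s = t - \<tau>'"
    have t: "t = s + \<tau>'" using that by (simp add: s_def)
    let ?M = "\<lambda>t. matrix_window QQ (t - \<tau>') t - J"
    let ?\<sigma> = "spectral_norm (?M t)"
    \<comment> \<open>On vectors annihilated by \<open>J\<close> the window product agrees with its
      difference from \<open>J\<close>, so the spectral norm in \<open>\<rho>'\<close> applies; the
      deviations are such vectors.\<close>
    have "norm (matrix_window QQ s t *v v) \<le> ?\<sigma> * norm v" if "J *v v = 0" for v
    proof -
      have "matrix_window QQ s t *v v = ?M t *v v"
        using that by (simp add: s_def matrix_vector_mult_diff_rdistrib)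
      then show ?thesis
        unfolding spectral_norm_def by (simp add: onorm[OF matrix_vector_mul_bounded_linear])
    qed
    note window = this[unfolded t]
    have "V t \<le> 4 * (1 + ?T\<^sup>2) * ?\<sigma>\<^sup>2 * V s
        + 2 * \<alpha>\<^sup>2 * (1 + ?T\<^sup>2) * ?T * (\<Sum>i\<in>{s..<t}. (norm (G i))\<^sup>2)"
      unfolding V_def t
      by (rule tracking_window_bound[where Q = QQ and X = X and Y = Y and G = G, OF contr Xrec Yrec window window])
        (simp_all add: JX JY matrix_vector_mult_diff_distrib matrix_vector_mult_scaleR)
    also have "4 * (1 + ?T\<^sup>2) * ?\<sigma>\<^sup>2 * V s \<le> 1 / 2 * V s"
    proof (rule mult_right_mono)
      have "?\<sigma>\<^sup>2 \<le> (MAX t\<in>{\<tau>'..max \<tau>' k}. (spectral_norm (?M t))\<^sup>2)"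
        using that by (intro Max_ge) auto
      then have "2 * (1 + ?T\<^sup>2) * ?\<sigma>\<^sup>2 \<le> \<rho>'"
        unfolding \<rho>'_def J_def by (intro mult_left_mono) auto
      then show "4 * (1 + ?T\<^sup>2) * ?\<sigma>\<^sup>2 \<le> 1 / 2" using \<rho>'_lt by linarith
    qed (rule V_nonneg)
    also have "2 * \<alpha>\<^sup>2 * (1 + ?T\<^sup>2) * ?T * (\<Sum>i\<in>{s..<t}. (norm (G i))\<^sup>2) \<le> c * (\<Sum>i\<in>{s..<t}. Z i)"
      by (rule forcing) simp
    finally show ?thesis by (simp add: s_def)
  qed
  \<comment> \<open>Before a full window has elapsed, start at index 0 and use only that mixing does
    not increase norms, that is \<open>\<sigma> = 1\<close>.\<close>
  have early: "V t \<le> 4 * (1 + ?T\<^sup>2) * V 0 + c * (\<Sum>i\<in>{t - \<tau>'..<t}. Z i)" if "t < \<tau>'" for t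
  proof -
    have "V (0 + t) \<le> 4 * (1 + (real t)\<^sup>2) * 1\<^sup>2 * V 0
        + 2 * \<alpha>\<^sup>2 * (1 + (real t)\<^sup>2) * real t * (\<Sum>i\<in>{0..<0 + t}. (norm (G i))\<^sup>2)"
      unfolding V_def
      by (rule tracking_window_bound[where Q = QQ and X = X and Y = Y and G = G, OF contr Xrec Yrec])
        (simp_all only: mult_1 norm_contraction_matrix_window[OF contr])
    also have "4 * (1 + (real t)\<^sup>2) * 1\<^sup>2 * V 0 \<le> 4 * (1 + ?T\<^sup>2) * V 0"
      using that V_nonneg by (intro mult_right_mono) (auto simp: power_mono)
    also have "2 * \<alpha>\<^sup>2 * (1 + (real t)\<^sup>2) * real t * (\<Sum>i\<in>{0..<0 + t}. (norm (G i))\<^sup>2) \<le> c * (\<Sum>i\<in>{0..<0 + t}. Z i)"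
      using that by (intro forcing) simp
    finally show ?thesis using that by simp
  qed

  \<comment> \<open>Weighted summation and absorption\<close>
  define q where "q = 1 / r"
  have r: "0 < r" "r < 1" using amu amuT \<beta>_lt amu_pos by (auto simp: r_def)
  have q_ge: "1 \<le> q" using r by (simp add: q_def)
  \<comment> \<open>Bernoulli's inequality gives \<open>r ^ \<tau>' \<ge> 1 - \<beta> / 2\<close>,
    and \<open>\<beta> / 2 < 1 / 232\<close> leaves more than \<open>100 / 101\<close>.\<close>
  have q_pow: "q ^ \<tau>' \<le> 101 / 100"
  proof -
    have "1 + ?T * (- (\<alpha> * \<mu> / 4)) \<le> (1 + (- (\<alpha> * \<mu> / 4))) ^ \<tau>'"
      using amu amuT \<beta>_lt by (intro Bernoulli_inequality) auto
    then have "100 / 101 \<le> r ^ \<tau>'"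
      using amuT \<beta>_lt by (simp add: r_def mult.commute)
    then show ?thesis using r by (simp add: q_def power_one_over field_simps)
  qed
  define A where "A = (\<Sum>t<k. q ^ t * V t)"
  define DD where "DD = (\<Sum>t<k. q ^ t * D t)"
  have A_nonneg: "0 \<le> A" and DD_nonneg: "0 \<le> DD"
    using q_ge V_nonneg D_nonneg by (auto simp: A_def DD_def intro!: sum_nonneg)
  have sum_Z: "(\<Sum>t<k. q ^ t * Z t) = 13 * A + 24 * \<alpha>\<^sup>2 * L * DD"
    by (simp add: A_def DD_def Z_def sum.distrib sum_distrib_left algebra_simps)
  have "A \<le> 101 / 100 * (1 / 2 * A + ?T * (4 * (1 + ?T\<^sup>2) * V 0) + c * ?T * (\<Sum>t<k. q ^ t * Z t))"
    unfolding A_def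
    by (rule weighted_sum_of_windowed_recursion_le[OF q_ge q_pow V_nonneg Z_nonneg c_nonneg _ _ late early])
      (use V_nonneg in auto)
  \<comment> \<open>The value \<open>1 / 3000\<close> rounds up \<open>4 / 116^2\<close>.\<close>
  also have "c * ?T * (\<Sum>t<k. q ^ t * Z t) \<le> 1 / 3000 * (13 * A + 24 * \<alpha>\<^sup>2 * L * DD)"
    unfolding sum_Z
  proof (rule mult_right_mono)
    have "c * ?T = 4 * \<beta>\<^sup>2"
      by (simp add: c_def \<beta>_def power2_eq_square power3_eq_cube mult_ac)
    moreover have "\<beta>\<^sup>2 \<le> (1 / 116)\<^sup>2" using \<beta>_lt \<beta>_pos by (intro power_mono) auto
    ultimately show "c * ?T \<le> 1 / 3000" by (simp add: power2_eq_square)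
    show "0 \<le> 13 * A + 24 * \<alpha>\<^sup>2 * L * DD" using A_nonneg DD_nonneg L_nonneg by simp
  qed
  finally have "A \<le> 101 / 100 * (1 / 2 * A + 4 * (?T * (1 + ?T\<^sup>2) * V 0)
      + 1 / 3000 * (13 * A + 24 * (\<alpha>\<^sup>2 * L * DD)))"
    by (simp add: mult_ac)
  moreover have "0 \<le> \<alpha>\<^sup>2 * L * DD" "0 \<le> ?T * (1 + ?T\<^sup>2) * V 0"
    using DD_nonneg L_nonneg V_nonneg by simp_all
  \<comment> \<open>The coefficient of \<open>a\<close> on the right is below 0.51; solving for
    \<open>a\<close> leaves less than \<open>8.3 * p + 0.017 * s\<close>, rounded up here.\<close>
  moreover have "a \<le> 9 * p + 1 / 50 * s"
    if "a \<le> 101 / 100 * (1 / 2 * a + 4 * p + 1 / 3000 * (13 * a + 24 * s))" "0 \<le> s" "0 \<le> p" for a p s :: real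
    using that by (simp add: field_simps)
  ultimately have A_le: "A \<le> 9 * (?T * (1 + ?T\<^sup>2) * V 0) + 1 / 50 * (\<alpha>\<^sup>2 * L * DD)"
    by blast
  have total: "3 * \<alpha> * L * A - \<alpha> * DD \<le> 1000 * L * (1 + ?T\<^sup>2) / \<mu> * V 0"
  proof -
    have "3 * (\<alpha> * L) * A \<le> 3 * (\<alpha> * L) * (9 * (?T * (1 + ?T\<^sup>2) * V 0) + 1 / 50 * (\<alpha>\<^sup>2 * L * DD))"
      using A_le aL_pos by (intro mult_left_mono) auto
    also have "\<dots> = 27 * (\<alpha> * ?T) * (L * (1 + ?T\<^sup>2) * V 0) + 3 / 50 * (\<alpha> * L)\<^sup>2 * (\<alpha> * DD)"
      by (simp add: algebra_simps power2_eq_square)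
    \<comment> \<open>The gap terms fed back through the deviations are a tiny multiple of
      \<open>\<alpha> * DD\<close> and are cancelled by the decrease of the mean iterate.\<close>
    also have "3 / 50 * (\<alpha> * L)\<^sup>2 * (\<alpha> * DD) \<le> 1 * (\<alpha> * DD)"
    proof (rule mult_right_mono)
      have "(\<alpha> * L)\<^sup>2 \<le> (1 / 116)\<^sup>2" using aL aLT \<beta>_lt aL_pos by (intro power_mono) auto
      then show "3 / 50 * (\<alpha> * L)\<^sup>2 \<le> 1" by (simp add: power2_eq_square)
    qed (use DD_nonneg \<alpha>_pos in simp)
    \<comment> \<open>The factor \<open>\<tau>'\<close> from the initial window is traded for
      \<open>1 / \<mu>\<close>, since \<open>\<alpha> * \<mu> * \<tau>'\<close> is at most
      \<open>2 * \<beta>\<close>; the constant 1000 is far from attained.\<close>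
    also have "27 * (\<alpha> * ?T) * (L * (1 + ?T\<^sup>2) * V 0) \<le> 1000 / \<mu> * (L * (1 + ?T\<^sup>2) * V 0)"
    proof (rule mult_right_mono)
      have "27 * (\<alpha> * ?T) * \<mu> \<le> 1000" using amuT \<beta>_lt by (simp add: mult_ac)
      then show "27 * (\<alpha> * ?T) \<le> 1000 / \<mu>" using \<mu>_pos by (simp add: pos_le_divide_eq)
    qed (use L_nonneg V_nonneg in simp)
    finally show ?thesis by (simp add: mult_ac)
  qed

  \<comment> \<open>Unrolling the recursion of the mean iterate\<close>
  have "(norm (node_mean (x k) - xstar))\<^sup>2 \<le> r ^ k * ((norm (node_mean (x 0) - xstar))\<^sup>2
      + 1 / r * (\<Sum>j<k. (1 / r) ^ j * ((3 * \<alpha> * L * V j - \<alpha> * D j) / ?n)))"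
    by (rule linear_recursion_le[where e = "\<lambda>j. (norm (node_mean (x j) - xstar))\<^sup>2", OF r(1) step])
  also have "(\<Sum>j<k. (1 / r) ^ j * ((3 * \<alpha> * L * V j - \<alpha> * D j) / ?n)) = (3 * \<alpha> * L * A - \<alpha> * DD) / ?n"
    by (simp add: A_def DD_def sum_distrib_left sum_subtractf[symmetric] sum_divide_distrib
        right_diff_distrib mult_ac flip: q_def)
  also have "r ^ k * ((norm (node_mean (x 0) - xstar))\<^sup>2 + 1 / r * ((3 * \<alpha> * L * A - \<alpha> * DD) / ?n))
    \<le> r ^ k * ((norm (node_mean (x 0) - xstar))\<^sup>2 + 1 / r * ((1000 * L * (1 + ?T\<^sup>2) / \<mu> * V 0) / ?n))"
    using total r by (intro mult_left_mono add_left_mono divide_right_mono) auto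
  also have "1 / r * ((1000 * L * (1 + ?T\<^sup>2) / \<mu> * V 0) / ?n)
      = 1000 * L * (1 + ?T\<^sup>2) / (\<mu> * ?n * r) * V 0"
    by (simp add: mult_ac)
  finally show ?thesis unfolding V_def X_def Y_def r_def .
qed

end
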